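(* Let $(A_{1},\mu_{1},\{\cdot,\cdot,\cdot\}_{1},\alpha_{1})$ and $(A_{2},\mu_{2},\{\cdot,\cdot,\cdot\}_{2},\alpha_{2})$ be two non-commutative ternary Hom-Nambu-Poisson algebras (respectively, two ternary Hom-Nambu-Poisson algebras). For $x_1,y_1,z_1\in A_1$ and $x_2,y_2,z_2\in A_2$ define on $A_1\oplus A_2$ the bilinear map $$\mu_{A_{1}\oplus A_{2}}(x_{1}+x_{2},y_{1}+y_{2})=\mu_{1}(x_{1},y_{1})+\mu_{2}(x_{2},y_{2}),$$ the trilinear map $$\{x_{1}+x_{2},y_{1}+y_{2},z_1+z_2\}_{A_{1}\oplus A_{2}}=\{x_1,y_1,z_1\}_1+\{x_2,y_2,z_2\}_2,$$ and the linear map $$\alpha_{A_{1}\oplus A_{2}}(x_1+x_2)=\alpha_1(x_1)+\alpha_2(x_2).$$ Then $(A_{1}\oplus A_{2},\mu_{A_{1}\oplus A_{2}},\{\cdot,\cdot,\cdot\}_{A_{1}\oplus A_{2}},\alpha_{A_{1}\oplus A_{2}})$ is a non-commutative ternary Hom-Nambu-Poisson algebra (respectively, a ternary Hom-Nambu-Poisson algebra).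
   Context: $\mathbb{K}$ is an algebraically closed field of characteristic zero; all vector spaces are over $\mathbb{K}$. A non-commutative ternary Hom-Nambu-Poisson algebra $(A,\mu,\{\cdot,\cdot,\cdot\},\alpha)$ consists of a vector space $A$, a bilinear map $\mu:A\times A\to A$, a trilinear map $\{\cdot,\cdot,\cdot\}:A\times A\times A\to A$ and a linear map $\alpha:A\to A$ such that, for all elements of $A$: (1) (Hom-associativity) $\mu(\alpha(x),\mu(y,z))=\mu(\mu(x,y),\alpha(z))$; (2) the bracket is skew-symmetric, $\{x_{\sigma(1)},x_{\sigma(2)},x_{\sigma(3)}\}=\mathrm{sgn}(\sigma)\{x_1,x_2,x_3\}$ for $\sigma\in S_3$, and satisfies the ternary Hom-Nambu identity $\{\alpha(x_1),\alpha(x_2),\{x_3,x_4,x_5\}\}=\{\{x_1,x_2,x_3\},\alpha(x_4),\alpha(x_5)\}+\{\alpha(x_3),\{x_1,x_2,x_4\},\alpha(x_5)\}+\{\alpha(x_3),\alpha(x_4),\{x_1,x_2,x_5\}\}$; (3) (Hom-Leibniz identity) $\{\mu(x_1,x_2),\alpha(x_3),\alpha(x_4)\}=\mu(\alpha(x_1),\{x_2,x_3,x_4\})+\mu(\{x_1,x_3,x_4\},\alpha(x_2))$. "Non-commutative" means that $\mu$ is not assumed commutative; when $\mu$ is commutative, it is called a ternary Hom-Nambu-Poisson algebra. *)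

theory Defs
  imports
    "HOL-Analysis.Product_Vector"
    "HOL-Combinatorics.Permutations"
    "HOL-Computational_Algebra.Polynomial"
begin

text \<open>
  A vector space is a whole type together with a scalar multiplication, as in the
  library locale \<^locale>\<open>vector_space\<close>.  Below, \<^term>\<open>Vector_Spaces.linear\<close>
  is linearity over an arbitrary field (not the real-vector constant of the same base name).
\<close>

definition bilinear_map ::
    "('k::field \<Rightarrow> 'a::ab_group_add \<Rightarrow> 'a) \<Rightarrow> ('a \<Rightarrow> 'a \<Rightarrow> 'a) \<Rightarrow> bool" where
  "bilinear_map s f \<longleftrightarrow>
     (\<forall>y. Vector_Spaces.linear s s (\<lambda>x. f x y)) \<and>
     (\<forall>x. Vector_Spaces.linear s s (\<lambda>y. f x y))"

definition trilinear_map ::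
    "('k::field \<Rightarrow> 'a::ab_group_add \<Rightarrow> 'a) \<Rightarrow> ('a \<Rightarrow> 'a \<Rightarrow> 'a \<Rightarrow> 'a) \<Rightarrow> bool" where
  "trilinear_map s f \<longleftrightarrow>
     (\<forall>y z. Vector_Spaces.linear s s (\<lambda>x. f x y z)) \<and>
     (\<forall>x z. Vector_Spaces.linear s s (\<lambda>y. f x y z)) \<and>
     (\<forall>x y. Vector_Spaces.linear s s (\<lambda>z. f x y z))"

locale noncomm_ternary_Hom_Nambu_Poisson =
  vector_space scale
  for scale :: "'k::field \<Rightarrow> 'a::ab_group_add \<Rightarrow> 'a" +
  fixes \<mu> :: "'a \<Rightarrow> 'a \<Rightarrow> 'a"
    and br :: "'a \<Rightarrow> 'a \<Rightarrow> 'a \<Rightarrow> 'a"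
    and \<alpha> :: "'a \<Rightarrow> 'a"
  assumes mu_bilinear: "bilinear_map scale \<mu>"
    and br_trilinear: "trilinear_map scale br"
    and alpha_linear: "Vector_Spaces.linear scale scale \<alpha>"
    and Hom_assoc: "\<mu> (\<alpha> x) (\<mu> y z) = \<mu> (\<mu> x y) (\<alpha> z)"
    and skew_symmetric:
      "\<sigma> permutes {1, 2, 3::nat} \<Longrightarrow>
         br (v (\<sigma> 1)) (v (\<sigma> 2)) (v (\<sigma> 3)) = scale (of_int (sign \<sigma>)) (br (v 1) (v 2) (v 3))"
    and Hom_Nambu:
      "br (\<alpha> x1) (\<alpha> x2) (br x3 x4 x5) =
         br (br x1 x2 x3) (\<alpha> x4) (\<alpha> x5) +
         br (\<alpha> x3) (br x1 x2 x4) (\<alpha> x5) +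
         br (\<alpha> x3) (\<alpha> x4) (br x1 x2 x5)"
    and Hom_Leibniz:
      "br (\<mu> x1 x2) (\<alpha> x3) (\<alpha> x4) =
         \<mu> (\<alpha> x1) (br x2 x3 x4) + \<mu> (br x1 x3 x4) (\<alpha> x2)"

locale ternary_Hom_Nambu_Poisson =
  noncomm_ternary_Hom_Nambu_Poisson scale \<mu> br \<alpha>
  for scale :: "'k::field \<Rightarrow> 'a::ab_group_add \<Rightarrow> 'a" and \<mu> br \<alpha> +
  assumes mu_commute: "\<mu> x y = \<mu> y x"

text \<open>
  The direct sum of two vector spaces is the product type, a pair \<open>(x1, x2)\<close> standing for
  \<open>x1 + x2\<close>, with the componentwise addition and the scalar multiplication
  \<^const>\<open>module_prod.scale\<close> of the library.
\<close>

definition dsum_mu ::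
    "('a \<Rightarrow> 'a \<Rightarrow> 'a) \<Rightarrow> ('b \<Rightarrow> 'b \<Rightarrow> 'b) \<Rightarrow> 'a \<times> 'b \<Rightarrow> 'a \<times> 'b \<Rightarrow> 'a \<times> 'b" where
  "dsum_mu \<mu>1 \<mu>2 = (\<lambda>(x1, x2) (y1, y2). (\<mu>1 x1 y1, \<mu>2 x2 y2))"

definition dsum_br ::
    "('a \<Rightarrow> 'a \<Rightarrow> 'a \<Rightarrow> 'a) \<Rightarrow> ('b \<Rightarrow> 'b \<Rightarrow> 'b \<Rightarrow> 'b) \<Rightarrow>
      'a \<times> 'b \<Rightarrow> 'a \<times> 'b \<Rightarrow> 'a \<times> 'b \<Rightarrow> 'a \<times> 'b" where
  "dsum_br br1 br2 = (\<lambda>(x1, x2) (y1, y2) (z1, z2). (br1 x1 y1 z1, br2 x2 y2 z2))"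

definition dsum_alpha :: "('a \<Rightarrow> 'a) \<Rightarrow> ('b \<Rightarrow> 'b) \<Rightarrow> 'a \<times> 'b \<Rightarrow> 'a \<times> 'b" where
  "dsum_alpha \<alpha>1 \<alpha>2 = (\<lambda>(x1, x2). (\<alpha>1 x1, \<alpha>2 x2))"

end

theory Submission
  imports Defs
begin

text \<open>Both projections of the direct sum commute with \<open>\<mu>\<close>, the bracket,
  \<open>\<alpha>\<close>, addition and scalar multiplication. An equation between pairs holds as
  soon as both coordinates agree, so each axiom, being a universally quantified identity, splits
  into the same identity in the two summands. For multilinearity, \<open>linear_prod_scale\<close>
  is applied one slot at a time; \<open>noncomm_ternary_Hom_Nambu_Poisson_dsum\<close> collects all
  axioms but commutativity, which is again checked coordinatewise.\<close>

lemma vector_space_prod_scale: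
  assumes "vector_space s1" and "vector_space s2"
  shows "vector_space (module_prod.scale s1 s2)"
proof -
  interpret a: vector_space s1 by fact
  interpret b: vector_space s2 by fact
  interpret vector_space_prod s1 s2 ..
  show ?thesis by (rule p.vector_space_axioms)
qed

text \<open>Freezing all arguments but one of a componentwise operation leaves a map of this shape,
  so this one fact serves every slot of the product and of the bracket, and the twisting map. It is
  phrased with \<open>fst\<close> and \<open>snd\<close> because \<open>case_prod_unfold\<close>
  produces that form.\<close>

lemma linear_prod_scale:
  assumes "Vector_Spaces.linear s1 s1 f" and "Vector_Spaces.linear s2 s2 g"
  shows "Vector_Spaces.linear (module_prod.scale s1 s2) (module_prod.scale s1 s2)
           (\<lambda>x. (f (fst x), g (snd x)))"
proof -
  interpret f: Vector_Spaces.linear s1 s1 f by fact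
  interpret g: Vector_Spaces.linear s2 s2 g by fact
  interpret module_prod s1 s2 ..
  show ?thesis
    by (simp add: Vector_Spaces.linear_iff vector_space_prod_scale f.vs1.vector_space_axioms
        g.vs1.vector_space_axioms scale_def f.add g.add f.scale g.scale)
qed

lemma noncomm_ternary_Hom_Nambu_Poisson_dsum:
  assumes "noncomm_ternary_Hom_Nambu_Poisson scale1 \<mu>1 br1 \<alpha>1"
    and "noncomm_ternary_Hom_Nambu_Poisson scale2 \<mu>2 br2 \<alpha>2"
  shows "noncomm_ternary_Hom_Nambu_Poisson (module_prod.scale scale1 scale2)
           (dsum_mu \<mu>1 \<mu>2) (dsum_br br1 br2) (dsum_alpha \<alpha>1 \<alpha>2)"
proof -
  interpret A: noncomm_ternary_Hom_Nambu_Poisson scale1 \<mu>1 br1 \<alpha>1 by fact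
  interpret B: noncomm_ternary_Hom_Nambu_Poisson scale2 \<mu>2 br2 \<alpha>2 by fact
  \<comment> \<open>From here on \<open>scale\<close> is the scalar multiplication of the direct
    sum.\<close>
  interpret vector_space_prod scale1 scale2 ..
  note dsum_defs = dsum_mu_def dsum_br_def dsum_alpha_def case_prod_unfold
  show ?thesis
  proof (intro noncomm_ternary_Hom_Nambu_Poisson.intro
      noncomm_ternary_Hom_Nambu_Poisson_axioms.intro)
    show "vector_space scale"
      by (rule p.vector_space_axioms)
    show "bilinear_map scale (dsum_mu \<mu>1 \<mu>2)"
      using A.mu_bilinear B.mu_bilinear
      by (auto simp: bilinear_map_def dsum_defs intro!: linear_prod_scale)
    show "trilinear_map scale (dsum_br br1 br2)"
      using A.br_trilinear B.br_trilinear
      by (auto simp: trilinear_map_def dsum_defs intro!: linear_prod_scale)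
    show "Vector_Spaces.linear scale scale (dsum_alpha \<alpha>1 \<alpha>2)"
      using A.alpha_linear B.alpha_linear
      by (auto simp: dsum_defs intro!: linear_prod_scale)
    show "dsum_br br1 br2 (v (\<sigma> 1)) (v (\<sigma> 2)) (v (\<sigma> 3)) =
        scale (of_int (sign \<sigma>)) (dsum_br br1 br2 (v 1) (v 2) (v 3))"
      if "\<sigma> permutes {1, 2, 3}" for \<sigma> :: "nat \<Rightarrow> nat" and v
      \<comment> \<open>Permuting the arguments commutes with projecting them, and both coordinates
        pick up the same scalar, the sign of \<open>\<sigma>\<close>, which therefore factors out of
        the pair.\<close>
      using A.skew_symmetric[OF that, of "fst \<circ> v"] B.skew_symmetric[OF that, of "snd \<circ> v"]
      by (simp add: dsum_defs scale_def)
  \<comment> \<open>Read from right to left, the Nambu and Leibniz identities fold each sum back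
    into a single bracket.\<close>
  qed (simp_all add: dsum_defs A.Hom_assoc[symmetric] B.Hom_assoc[symmetric]
      A.Hom_Nambu[symmetric] B.Hom_Nambu[symmetric] A.Hom_Leibniz[symmetric]
      B.Hom_Leibniz[symmetric])
qed

theorem theorem3p1:
  fixes scale1 :: "'k::{alg_closed_field, field_char_0} \<Rightarrow> 'a::ab_group_add \<Rightarrow> 'a"
    and scale2 :: "'k \<Rightarrow> 'b::ab_group_add \<Rightarrow> 'b"
    and \<mu>1 :: "'a \<Rightarrow> 'a \<Rightarrow> 'a" and \<mu>2 :: "'b \<Rightarrow> 'b \<Rightarrow> 'b"
    and br1 :: "'a \<Rightarrow> 'a \<Rightarrow> 'a \<Rightarrow> 'a" and br2 :: "'b \<Rightarrow> 'b \<Rightarrow> 'b \<Rightarrow> 'b"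
    and \<alpha>1 :: "'a \<Rightarrow> 'a" and \<alpha>2 :: "'b \<Rightarrow> 'b"
  shows "(noncomm_ternary_Hom_Nambu_Poisson scale1 \<mu>1 br1 \<alpha>1 \<and>
          noncomm_ternary_Hom_Nambu_Poisson scale2 \<mu>2 br2 \<alpha>2 \<longrightarrow>
          noncomm_ternary_Hom_Nambu_Poisson (module_prod.scale scale1 scale2)
            (dsum_mu \<mu>1 \<mu>2) (dsum_br br1 br2) (dsum_alpha \<alpha>1 \<alpha>2)) \<and>
         (ternary_Hom_Nambu_Poisson scale1 \<mu>1 br1 \<alpha>1 \<and>
          ternary_Hom_Nambu_Poisson scale2 \<mu>2 br2 \<alpha>2 \<longrightarrow>
          ternary_Hom_Nambu_Poisson (module_prod.scale scale1 scale2)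
            (dsum_mu \<mu>1 \<mu>2) (dsum_br br1 br2) (dsum_alpha \<alpha>1 \<alpha>2))"
  \<comment> \<open>Unfolding \<open>dsum_mu\<close> reduces commutativity to the two coordinates;
    the lemma is unfolded likewise so that it still matches the goal.\<close>
  by (auto simp: ternary_Hom_Nambu_Poisson_def ternary_Hom_Nambu_Poisson_axioms_def dsum_mu_def
      intro: noncomm_ternary_Hom_Nambu_Poisson_dsum[unfolded dsum_mu_def])

end
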